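(* Let $A$ be a semisimple, locally convex Abelian $*$-algebra and let $\Delta_A$ be its Gel'fand spectrum. Then the Gel'fand transform $\hat{\ }\colon A\to C(\Delta_A)$, $\hat a(p)=p(a)$ for $a\in A$ and $p\in\Delta_A$, is a $*$-homomorphism whose image is a dense $*$-subalgebra of $C(\Delta_A)$, where $C(\Delta_A)$ is the $*$-algebra of continuous complex functions on $\Delta_A$ with the compact-open topology.
   Context: An algebra is a complex vector space $A$ with an associative bilinear multiplication and a unit $1_A$; it is Abelian if $ab=ba$ for all $a,b$. Algebra homomorphisms are linear, multiplicative and map unit to unit. A $*$-algebra is an algebra with an involution $*\colon A\to A$, i.e. an anti-linear map with $a^{**}=a$, $(z1_A)^*=\bar z1_A$ and $(ab)^*=b^*a^*$; a $*$-homomorphism is an algebra homomorphism $f$ with $f(a^* )=f(a)^*$ for all $a$. $\mathbb{C}$ is a $*$-algebra under complex conjugation, with its usual topology. A locally convex $*$-algebra is a $*$-algebra with a locally convex vector space topology making all the algebra operations and the involution continuous. The Gel'fand spectrum $\Delta_A$ of a locally convex Abelian $*$-algebra $A$ is the set of all continuous $*$-homomorphisms $p\colon A\to\mathbb{C}$, with the weak${}^*$ topology, i.e. the weakest topology making every function $p\mapsto p(a)$, $a\in A$, continuous. $A$ is called semisimple if its Gel'fand transform is one-to-one, i.e. if for every nonzero $a\in A$ there is $p\in\Delta_A$ with $p(a)\neq 0$. $C(\Delta_A)$ has pointwise operations and pointwise complex conjugation as involution; its compact-open topology is the locally convex topology defined by the seminorms $|f|_K=\sup_{p\in K}|f(p)|$,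 with $K$ ranging over the compact subsets of $\Delta_A$. *)

theory Defs
  imports "HOL-Analysis.Analysis" "HOL-Algebra.Module" "HOL-Algebra.Subrings"
begin

section \<open>Complex algebras and *-algebras\<close>

record ('a, 'b) star_alg = "('a, 'b) module" +
  star :: "'b \<Rightarrow> 'b"

definition complex_alg :: "(complex, complex) star_alg" where
  "complex_alg =
    \<lparr>carrier = UNIV, mult = (*), one = 1, zero = 0, add = (+), smult = (*), star = cnj\<rparr>"

text \<open>Multiplication need not be commutative here and the zero algebra is allowed; the field of
  scalars is the underlying ring of \<^const>\<open>complex_alg\<close>.\<close>

locale complex_algebra = ring A + Module.module complex_alg A
  for A :: "(complex, 'a, 'm) module_scheme" (structure) +
  assumes smult_mult_left: "\<lbrakk>x \<in> carrier A; y \<in> carrier A\<rbrakk> \<Longrightarrow> (z \<odot> x) \<otimes> y = z \<odot> (x \<otimes> y)"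
    and smult_mult_right: "\<lbrakk>x \<in> carrier A; y \<in> carrier A\<rbrakk> \<Longrightarrow> x \<otimes> (z \<odot> y) = z \<odot> (x \<otimes> y)"

locale star_algebra = complex_algebra A
  for A :: "(complex, 'a, 'm) star_alg_scheme" (structure) +
  assumes star_closed: "x \<in> carrier A \<Longrightarrow> star A x \<in> carrier A"
    and star_add: "\<lbrakk>x \<in> carrier A; y \<in> carrier A\<rbrakk> \<Longrightarrow> star A (x \<oplus> y) = star A x \<oplus> star A y"
    and star_smult: "x \<in> carrier A \<Longrightarrow> star A (z \<odot> x) = cnj z \<odot> star A x"
    and star_star: "x \<in> carrier A \<Longrightarrow> star A (star A x) = x"
    and star_unit: "star A (z \<odot> \<one>) = cnj z \<odot> \<one>"
    and star_mult: "\<lbrakk>x \<in> carrier A; y \<in> carrier A\<rbrakk> \<Longrightarrow> star A (x \<otimes> y) = star A y \<otimes> star A x"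

definition star_hom ::
  "(complex, 'a, 'm) star_alg_scheme \<Rightarrow> (complex, 'b, 'n) star_alg_scheme \<Rightarrow> ('a \<Rightarrow> 'b) set" where
  "star_hom A B = {f \<in> ring_hom A B.
     (\<forall>z. \<forall>x \<in> carrier A. f (z \<odot>\<^bsub>A\<^esub> x) = z \<odot>\<^bsub>B\<^esub> f x) \<and>
     (\<forall>x \<in> carrier A. f (star A x) = star B (f x))}"

definition star_subalgebra :: "'b set \<Rightarrow> (complex, 'b, 'n) star_alg_scheme \<Rightarrow> bool" where
  "star_subalgebra S B \<longleftrightarrow> subring S B \<and>
     (\<forall>z. \<forall>x \<in> S. z \<odot>\<^bsub>B\<^esub> x \<in> S) \<and> (\<forall>x \<in> S. star B x \<in> S)"

text \<open>Local convexity is the existence of a base of convex neighbourhoods of zero; the Hausdorff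
  property is not required. Multiplication is jointly continuous.\<close>

locale locally_convex_star_algebra = star_algebra A
  for A :: "(complex, 'a, 'm) star_alg_scheme" (structure) and T :: "'a topology" +
  assumes topspace_carrier: "topspace T = carrier A"
    and continuous_add: "continuous_map (prod_topology T T) T (\<lambda>(x, y). x \<oplus> y)"
    and continuous_smult: "continuous_map (prod_topology euclidean T) T (\<lambda>(z, x). z \<odot> x)"
    and continuous_mult: "continuous_map (prod_topology T T) T (\<lambda>(x, y). x \<otimes> y)"
    and continuous_star: "continuous_map T T (star A)"
    and locally_convex: "\<lbrakk>openin T U; \<zero> \<in> U\<rbrakk> \<Longrightarrow>
      \<exists>V. openin T V \<and> \<zero> \<in> V \<and> V \<subseteq> U \<and>
        (\<forall>x \<in> V. \<forall>y \<in> V. \<forall>t \<in> {0..1::real}.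
          complex_of_real t \<odot> x \<oplus> complex_of_real (1 - t) \<odot> y \<in> V)"

section \<open>The Gel'fand spectrum\<close>

text \<open>Maps on the carrier are represented by their extensional representatives, so that maps
  agreeing on the carrier are equal.\<close>

definition spectrum ::
  "(complex, 'a, 'm) star_alg_scheme \<Rightarrow> 'a topology \<Rightarrow> ('a \<Rightarrow> complex) set" where
  "spectrum A T = {p \<in> extensional (carrier A).
     p \<in> star_hom A complex_alg \<and> continuous_map T euclidean p}"

definition spectrum_topology ::
  "(complex, 'a, 'm) star_alg_scheme \<Rightarrow> 'a topology \<Rightarrow> ('a \<Rightarrow> complex) topology" where
  "spectrum_topology A T = topology_generated_by
     {{p \<in> spectrum A T. p a \<in> U} | a U. a \<in> carrier A \<and> open U}"

definition gelfand ::
  "(complex, 'a, 'm) star_alg_scheme \<Rightarrow> 'a topology \<Rightarrow> 'a \<Rightarrow> ('a \<Rightarrow> complex) \<Rightarrow> complex" where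
  "gelfand A T a = (\<lambda>p \<in> spectrum A T. p a)"

definition semisimple :: "(complex, 'a, 'm) star_alg_scheme \<Rightarrow> 'a topology \<Rightarrow> bool" where
  "semisimple A T \<longleftrightarrow> inj_on (gelfand A T) (carrier A)"

section \<open>Continuous complex functions with the compact-open topology\<close>

definition cfun_alg :: "'x topology \<Rightarrow> (complex, 'x \<Rightarrow> complex) star_alg" where
  "cfun_alg X =
    \<lparr>carrier = {f \<in> extensional (topspace X). continuous_map X euclidean f},
     mult = (\<lambda>f g. \<lambda>x \<in> topspace X. f x * g x),
     one = (\<lambda>x \<in> topspace X. 1),
     zero = (\<lambda>x \<in> topspace X. 0),
     add = (\<lambda>f g. \<lambda>x \<in> topspace X. f x + g x),
     smult = (\<lambda>z f. \<lambda>x \<in> topspace X. z * f x),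
     star = (\<lambda>f. \<lambda>x \<in> topspace X. cnj (f x))\<rparr>"

text \<open>Inserting zero only matters for empty \<open>K\<close>, where the supremum is then zero.\<close>

definition sup_seminorm :: "'x set \<Rightarrow> ('x \<Rightarrow> complex) \<Rightarrow> real" where
  "sup_seminorm K f = Sup (insert 0 ((\<lambda>x. cmod (f x)) ` K))"

definition compact_open :: "'x topology \<Rightarrow> ('x \<Rightarrow> complex) topology" where
  "compact_open X = topology_generated_by
     {{g \<in> carrier (cfun_alg X). sup_seminorm K (\<lambda>x. g x - f x) < r} | f K r.
        f \<in> carrier (cfun_alg X) \<and> compactin X K \<and> 0 < r}"

section \<open>Basic facts\<close>

lemma topspace_spectrum_topology:
  assumes "carrier A \<noteq> {}"
  shows "topspace (spectrum_topology A T) = spectrum A T"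
  using assms unfolding spectrum_topology_def topology_generated_by_topspace by blast

lemma continuous_map_evaluation:
  assumes "a \<in> carrier A"
  shows "continuous_map (spectrum_topology A T) euclidean (\<lambda>p. p a)"
proof -
  have ne: "carrier A \<noteq> {}" using assms by auto
  show ?thesis
    unfolding continuous_map_def topspace_spectrum_topology[OF ne]
    using assms by (auto simp: spectrum_topology_def intro!: topology_generated_by_Basis)
qed

lemma spectrum_topology_weakest:
  assumes Y: "topspace Y = spectrum A T"
    and cont: "\<And>a. a \<in> carrier A \<Longrightarrow> continuous_map Y euclidean (\<lambda>p. p a)"
    and U: "openin (spectrum_topology A T) U"
  shows "openin Y U"
proof -
  have basis: "openin Y {p \<in> spectrum A T. p a \<in> V}" if "a \<in> carrier A" "open V" for a V
    using cont[OF that(1)] that(2) by (auto simp: continuous_map_def Y)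
  have "generate_topology_on
      {{p \<in> spectrum A T. p a \<in> V} | a V. a \<in> carrier A \<and> open V} U"
    using U by (simp add: spectrum_topology_def openin_topology_generated_by_iff)
  then show ?thesis
    by induction (use basis in auto)
qed

lemma continuous_map_restrict_topspace [simp]:
  "continuous_map X Y (restrict f (topspace X)) \<longleftrightarrow> continuous_map X Y f"
  by (auto elim: continuous_map_eq)

lemma topspace_compact_open: "topspace (compact_open X) = carrier (cfun_alg X)"
proof -
  let ?B = "{{g \<in> carrier (cfun_alg X). sup_seminorm K (\<lambda>x. g x - f x) < r} | f K r.
        f \<in> carrier (cfun_alg X) \<and> compactin X K \<and> 0 < r}"
  have "(\<lambda>x \<in> topspace X. 0) \<in> carrier (cfun_alg X)"
    by (simp add: cfun_alg_def)
  moreover have "carrier (cfun_alg X) =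
      {g \<in> carrier (cfun_alg X). sup_seminorm {} (\<lambda>x. g x - f x) < 1}" for f
    by (simp add: sup_seminorm_def)
  ultimately have "carrier (cfun_alg X) \<in> ?B"
    using compactin_empty zero_less_one by blast
  then show ?thesis
    unfolding compact_open_def topology_generated_by_topspace by blast
qed

lemma cring_complex_alg: "cring complex_alg"
  by (rule cringI; (rule abelian_groupI comm_monoidI)?)
    (auto simp: complex_alg_def algebra_simps intro: exI[of _ "- x" for x])

lemma star_algebra_complex_alg: "star_algebra complex_alg"
proof -
  interpret cring complex_alg by (rule cring_complex_alg)
  show ?thesis
    by unfold_locales (auto simp: complex_alg_def algebra_simps)
qed

lemma continuous_map_complex_mult:
  fixes f g :: "'x \<Rightarrow> complex"
  assumes "continuous_map X euclidean f" "continuous_map X euclidean g"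
  shows "continuous_map X euclidean (\<lambda>x. f x * g x)"
  using assms by (simp add: continuous_map_atin tendsto_mult)

lemma continuous_map_cnj:
  assumes "continuous_map X euclidean f"
  shows "continuous_map X euclidean (\<lambda>x. cnj (f x))"
  using assms by (simp add: continuous_map_atin tendsto_cnj)

lemma cring_cfun_alg: "cring (cfun_alg X)"
proof (rule cringI)
  show "abelian_group (cfun_alg X)"
  proof (rule abelian_groupI)
    fix f assume "f \<in> carrier (cfun_alg X)"
    then show "\<exists>g \<in> carrier (cfun_alg X). g \<oplus>\<^bsub>cfun_alg X\<^esub> f = \<zero>\<^bsub>cfun_alg X\<^esub>"
      by (intro bexI[of _ "\<lambda>x \<in> topspace X. - f x"])
        (auto simp: cfun_alg_def)
  qed (auto simp: cfun_alg_def fun_eq_iff extensional_def algebra_simps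
        intro!: continuous_map_add)
  show "comm_monoid (cfun_alg X)"
    by (rule comm_monoidI)
      (auto simp: cfun_alg_def fun_eq_iff extensional_def algebra_simps
        intro!: continuous_map_complex_mult)
qed (auto simp: cfun_alg_def fun_eq_iff algebra_simps)

lemma star_algebra_cfun_alg: "star_algebra (cfun_alg X)"
proof -
  interpret C: cring complex_alg by (rule cring_complex_alg)
  interpret cring "cfun_alg X" by (rule cring_cfun_alg)
  show ?thesis
    by unfold_locales
      (auto simp: cfun_alg_def complex_alg_def fun_eq_iff extensional_def algebra_simps
        intro!: continuous_map_complex_mult continuous_map_cnj)
qed

end

theory Submission
  imports Defs
begin

text \<open>
  The algebraic claims hold because the elements of the spectrum are themselves unital
  *-homomorphisms and the operations of the function algebra are pointwise. Density is the
  Stone--Weierstrass theorem, applied on one compact subset of the spectrum at a time: a compact-open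
  neighbourhood of a function only controls it on some compact set \<open>K\<close>, up to some \<open>r > 0\<close>
  (\<open>compact_open_nhd\<close>), so it suffices to approximate uniformly on \<open>K\<close>. The transforms form a
  conjugation-closed unital algebra of continuous functions, and they separate the points of the
  spectrum for the trivial reason that two characters with the same values on the algebra are equal.

  The Stone--Weierstrass theorem is formulated for Hausdorff type classes, whereas the spectrum is a
  topology on a set of functions. The bridge is that the weak* topology is the topology of pointwise
  convergence: the spectrum is a subspace of the full function type with its product topology
  (\<open>continuous_map_spectrum_inclusion\<close>, \<open>continuous_on_spectrum\<close>), so that compactness and
  continuity carry over to the type-class notions.
\<close>

section \<open>The complex Stone--Weierstrass theorem\<close>

lemma open_fun_coordinate_vimage:
  fixes W :: "'b::topological_space set"
  assumes "open W"
  shows "open ((\<lambda>f :: 'a \<Rightarrow> 'b. f i) -` W)"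
  using assms continuous_on_product_coordinates by (rule open_vimage)

text \<open>Function types over a countable domain with metric values already are metric spaces, hence
  belong to each separation class. A more general Hausdorff instance is coherent with these
  arities only if the weaker separation classes are generalised first, one at a time.\<close>

instance "fun" :: (type, t0_space) t0_space
proof
  fix f g :: "'a \<Rightarrow> 'b"
  assume "f \<noteq> g"
  then obtain i where "f i \<noteq> g i"
    by blast
  then obtain U where "open U" "\<not> (f i \<in> U \<longleftrightarrow> g i \<in> U)"
    using separation_t0[of "f i" "g i"] by metis
  then show "\<exists>U. open U \<and> \<not> (f \<in> U \<longleftrightarrow> g \<in> U)"
    by (intro exI[of _ "(\<lambda>h. h i) -` U"]) (simp add: open_fun_coordinate_vimage)
qed

instance "fun" :: (type, t1_space) t1_space
proof
  fix f g :: "'a \<Rightarrow> 'b"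
  assume "f \<noteq> g"
  then obtain i where "f i \<noteq> g i"
    by blast
  then obtain U where "open U" "f i \<in> U" "g i \<notin> U"
    using t1_space[of "f i" "g i"] by metis
  then show "\<exists>U. open U \<and> f \<in> U \<and> g \<notin> U"
    by (intro exI[of _ "(\<lambda>h. h i) -` U"]) (simp add: open_fun_coordinate_vimage)
qed

instance "fun" :: (type, t2_space) t2_space
proof
  fix f g :: "'a \<Rightarrow> 'b"
  assume "f \<noteq> g"
  then obtain i where "f i \<noteq> g i"
    by blast
  then obtain U V where "open U" "open V" "f i \<in> U" "g i \<in> V" "U \<inter> V = {}"
    using hausdorff[of "f i" "g i"] by metis
  then show "\<exists>U V. open U \<and> open V \<and> f \<in> U \<and> g \<in> V \<and> U \<inter> V = {}"
    by (intro exI[of _ "(\<lambda>h. h i) -` U"] exI[of _ "(\<lambda>h. h i) -` V"])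
      (auto simp: open_fun_coordinate_vimage)
qed

text \<open>The functions in \<open>B\<close> that are real-valued form a real algebra, to which the real theorem
  applies. Closure under conjugation puts the real and imaginary parts of every member of \<open>B\<close>
  into it, so it still separates points; the real and imaginary parts of the given function are
  then approximated separately.\<close>

lemma Stone_Weierstrass_complex:
  fixes B :: "('x::t2_space \<Rightarrow> complex) set"
  assumes S: "compact S"
    and cont: "\<And>f. f \<in> B \<Longrightarrow> continuous_on S f"
    and one: "(\<lambda>_. 1) \<in> B"
    and add: "\<And>f g. f \<in> B \<Longrightarrow> g \<in> B \<Longrightarrow> (\<lambda>x. f x + g x) \<in> B"
    and mult: "\<And>f g. f \<in> B \<Longrightarrow> g \<in> B \<Longrightarrow> (\<lambda>x. f x * g x) \<in> B"
    and scale: "\<And>z f. f \<in> B \<Longrightarrow> (\<lambda>x. z * f x) \<in> B"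
    and cnj: "\<And>f. f \<in> B \<Longrightarrow> (\<lambda>x. cnj (f x)) \<in> B"
    and sep: "\<And>x y. x \<in> S \<Longrightarrow> y \<in> S \<Longrightarrow> x \<noteq> y \<Longrightarrow> \<exists>f \<in> B. f x \<noteq> f y"
    and g: "continuous_on S g" and e: "0 < e"
  shows "\<exists>f \<in> B. \<forall>x \<in> S. cmod (f x - g x) < e"
proof -
  define R where "R = {u. (\<lambda>x. complex_of_real (u x)) \<in> B}"
  have Re_in: "(\<lambda>x. Re (f x)) \<in> R" if "f \<in> B" for f
  proof -
    have "(\<lambda>x. (1 / 2) * (f x + cnj (f x))) \<in> B"
      using that by (intro scale add cnj)
    moreover have "(1 / 2) * (f x + cnj (f x)) = complex_of_real (Re (f x))" for x
      by (simp add: complex_add_cnj)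
    ultimately show ?thesis
      by (simp add: R_def)
  qed
  have Im_in: "(\<lambda>x. Im (f x)) \<in> R" if "f \<in> B" for f
    using Re_in[OF scale[OF that, of "- \<i>"]] by simp
  interpret R: function_ring_on R S
  proof
    show "continuous_on S u" if "u \<in> R" for u
      using cont[of "\<lambda>x. complex_of_real (u x)"] that continuous_on_Re by (fastforce simp: R_def)
    show "(\<lambda>_. c) \<in> R" for c
      using scale[OF one, of "complex_of_real c"] by (simp add: R_def)
    show "\<exists>u \<in> R. u x \<noteq> u y" if xy: "x \<in> S" "y \<in> S" "x \<noteq> y" for x y
    proof -
      obtain f where f: "f \<in> B" "f x \<noteq> f y"
        using sep[OF xy] by blast
      then have "Re (f x) \<noteq> Re (f y) \<or> Im (f x) \<noteq> Im (f y)"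
        by (simp add: complex_eq_iff)
      then show ?thesis
        using bexI[OF _ Re_in[OF f(1)]] bexI[OF _ Im_in[OF f(1)]] by meson
    qed
  qed (use S add mult in \<open>auto simp: R_def\<close>)
  have "continuous_on S (\<lambda>x. Re (g x))" "continuous_on S (\<lambda>x. Im (g x))"
    using g by (intro continuous_intros; simp)+
  then obtain u v where u: "u \<in> R" "\<And>x. x \<in> S \<Longrightarrow> \<bar>Re (g x) - u x\<bar> < e / 2"
    and v: "v \<in> R" "\<And>x. x \<in> S \<Longrightarrow> \<bar>Im (g x) - v x\<bar> < e / 2"
    using R.Stone_Weierstrass_basic[of "\<lambda>x. Re (g x)" "e / 2"]
      R.Stone_Weierstrass_basic[of "\<lambda>x. Im (g x)" "e / 2"] e by auto
  show ?thesis
  proof (intro bexI ballI)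
    show "(\<lambda>x. complex_of_real (u x) + \<i> * complex_of_real (v x)) \<in> B"
      using u(1) v(1) unfolding R_def by (intro add scale) auto
    show "cmod (complex_of_real (u x) + \<i> * complex_of_real (v x) - g x) < e" if "x \<in> S" for x
      using cmod_le[of "complex_of_real (u x) + \<i> * complex_of_real (v x) - g x"]
        u(2)[OF that] v(2)[OF that] by (simp add: abs_minus_commute)
  qed
qed

section \<open>Neighbourhoods in the compact-open topology\<close>

lemma sup_seminorm_le:
  assumes "0 \<le> r" "\<And>x. x \<in> K \<Longrightarrow> cmod (f x) \<le> r"
  shows "sup_seminorm K f \<le> r"
  unfolding sup_seminorm_def using assms by (intro cSup_least) auto

lemma cmod_le_sup_seminorm:
  assumes "compactin X K" "continuous_map X euclidean f" "x \<in> K"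
  shows "cmod (f x) \<le> sup_seminorm K f"
proof -
  have "compact (f ` K)"
    using image_compactin[OF assms(1,2)] by simp
  then have "bdd_above ((\<lambda>x. cmod (f x)) ` K)"
    using compact_imp_bounded[of "f ` K"] unfolding bounded_iff by fast
  then show ?thesis
    unfolding sup_seminorm_def using assms(3) by (intro cSup_upper) auto
qed

lemma sup_seminorm_nonneg:
  assumes "compactin X K" "continuous_map X euclidean f"
  shows "0 \<le> sup_seminorm K f"
proof (cases "K = {}")
  case False
  then show ?thesis
    using cmod_le_sup_seminorm[OF assms] norm_ge_zero order_trans by blast
qed (simp add: sup_seminorm_def)

lemma continuous_map_cfun_diff:
  assumes "f \<in> carrier (cfun_alg X)" "g \<in> carrier (cfun_alg X)"
  shows "continuous_map X euclidean (\<lambda>x. f x - g x)"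
  using assms by (auto simp: cfun_alg_def intro: continuous_map_diff)

text \<open>The defining subbase consists of seminorm balls with arbitrary centres. Every such ball around
  \<open>f\<close> that contains \<open>g\<close> contains a smaller ball around \<open>g\<close> by the triangle inequality, and finitely
  many compact sets can be merged into their union.\<close>

lemma compact_open_nhd:
  assumes U: "openin (compact_open X) U" and g: "g \<in> U"
  obtains K r where "compactin X K" "0 < r"
    "\<And>h. h \<in> carrier (cfun_alg X) \<Longrightarrow> (\<And>x. x \<in> K \<Longrightarrow> cmod (h x - g x) < r) \<Longrightarrow> h \<in> U"
proof -
  have "generate_topology_on
     {{g \<in> carrier (cfun_alg X). sup_seminorm K (\<lambda>x. g x - f x) < r} | f K r.
        f \<in> carrier (cfun_alg X) \<and> compactin X K \<and> 0 < r} U"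
    using U by (simp add: compact_open_def openin_topology_generated_by_iff)
  then have "\<exists>K r. compactin X K \<and> 0 < r \<and>
    (\<forall>h \<in> carrier (cfun_alg X). (\<forall>x \<in> K. cmod (h x - g x) < r) \<longrightarrow> h \<in> U)"
    using g
  proof (induction arbitrary: g)
    case Empty
    then show ?case by simp
  next
    case (Int U V)
    obtain K r where K: "compactin X K" "0 < r"
      "\<forall>h \<in> carrier (cfun_alg X). (\<forall>x \<in> K. cmod (h x - g x) < r) \<longrightarrow> h \<in> U"
      using Int.IH(1)[of g] Int.prems by auto
    obtain L s where L: "compactin X L" "0 < s"
      "\<forall>h \<in> carrier (cfun_alg X). (\<forall>x \<in> L. cmod (h x - g x) < s) \<longrightarrow> h \<in> V"
      using Int.IH(2)[of g] Int.prems by auto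
    show ?case
      using K L by (intro exI[of _ "K \<union> L"] exI[of _ "min r s"]) (auto intro: compactin_Un)
  next
    case (UN \<U>)
    then obtain V where "V \<in> \<U>" "g \<in> V" by blast
    with UN.IH[OF this] show ?case by (meson UnionI)
  next
    case (Basis W)
    then obtain f K r where f: "f \<in> carrier (cfun_alg X)" and K: "compactin X K"
      and W: "W = {h \<in> carrier (cfun_alg X). sup_seminorm K (\<lambda>x. h x - f x) < r}"
      by blast
    define s where "s = sup_seminorm K (\<lambda>x. g x - f x)"
    have gW: "g \<in> carrier (cfun_alg X)" "s < r"
      using Basis.prems by (auto simp: W s_def)
    note cont = continuous_map_cfun_diff[OF gW(1) f]
    have s0: "0 \<le> s"
      unfolding s_def using sup_seminorm_nonneg[OF K cont] .
    \<comment> \<open>Half the gap, because strict bounds at the points of \<open>K\<close> bound the supremum only weakly.\<close>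
    have "h \<in> W" if h: "h \<in> carrier (cfun_alg X)"
      and near: "\<forall>x \<in> K. cmod (h x - g x) < (r - s) / 2" for h
    proof -
      have "cmod (h x - f x) \<le> (r + s) / 2" if x: "x \<in> K" for x
      proof -
        have "cmod (h x - f x) \<le> cmod (h x - g x) + cmod (g x - f x)"
          using norm_triangle_ineq[of "h x - g x" "g x - f x"] by simp
        also have "\<dots> \<le> (r - s) / 2 + s"
          using near x cmod_le_sup_seminorm[OF K cont x] unfolding s_def[symmetric]
          by (intro add_mono) (auto intro: less_imp_le)
        also have "\<dots> = (r + s) / 2"
          by (simp add: field_simps)
        finally show ?thesis .
      qed
      then have "sup_seminorm K (\<lambda>x. h x - f x) \<le> (r + s) / 2"
        using s0 gW(2) by (intro sup_seminorm_le) auto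
      with gW(2) h show ?thesis by (simp add: W)
    qed
    then show ?case
      using K gW(2) by (intro exI[of _ K] exI[of _ "(r - s) / 2"]) auto
  qed
  then show ?thesis
    using that by blast
qed

section \<open>The spectrum as a space of functions with pointwise convergence\<close>

text \<open>Outside the carrier all members of the spectrum take the same default value, so these
  coordinates are constant and do not disturb continuity.\<close>

lemma continuous_map_spectrum_inclusion:
  assumes "carrier A \<noteq> {}"
  shows "continuous_map (spectrum_topology A T) euclidean (\<lambda>p. p)"
proof -
  have "continuous_map (spectrum_topology A T) euclidean (\<lambda>p. p a)" for a
  proof (cases "a \<in> carrier A")
    case True
    then show ?thesis by (rule continuous_map_evaluation)
  next
    case False
    then have "undefined = p a" if "p \<in> topspace (spectrum_topology A T)" for p
      using that by (auto simp: topspace_spectrum_topology[OF assms] spectrum_def extensional_def)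
    then show ?thesis
      using continuous_map_eq[of "spectrum_topology A T" euclidean "\<lambda>_. undefined" "\<lambda>p. p a"]
      by simp
  qed
  then have "continuous_map (spectrum_topology A T)
      (product_topology (\<lambda>_. euclidean) UNIV) (\<lambda>p. p)"
    by (intro continuous_map_coordinatewise_then_product) auto
  then show ?thesis
    by (simp add: euclidean_product_topology)
qed

lemma compact_spectrum:
  assumes "carrier A \<noteq> {}" "compactin (spectrum_topology A T) K"
  shows "compact K"
  using image_compactin[OF assms(2) continuous_map_spectrum_inclusion[OF assms(1)]] by simp

lemma continuous_on_spectrum:
  assumes ne: "carrier A \<noteq> {}" and f: "continuous_map (spectrum_topology A T) euclidean f"
  shows "continuous_on (spectrum A T) f"
proof -
  let ?Y = "top_of_set (spectrum A T)"
  have "openin ?Y U" if "openin (spectrum_topology A T) U" for U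
  proof (rule spectrum_topology_weakest[OF _ _ that])
    show "continuous_map ?Y euclidean (\<lambda>p. p a)" for a
      using continuous_on_subset[OF continuous_on_product_coordinates] by auto
  qed simp
  then have "continuous_map ?Y euclidean f"
    using f by (auto simp: continuous_map_def topspace_spectrum_topology[OF ne])
  then show ?thesis by simp
qed

section \<open>The Gel'fand transform\<close>

lemma star_homD:
  assumes "f \<in> star_hom A B"
  shows "x \<in> carrier A \<Longrightarrow> f x \<in> carrier B"
    and "x \<in> carrier A \<Longrightarrow> y \<in> carrier A \<Longrightarrow> f (x \<oplus>\<^bsub>A\<^esub> y) = f x \<oplus>\<^bsub>B\<^esub> f y"
    and "x \<in> carrier A \<Longrightarrow> y \<in> carrier A \<Longrightarrow> f (x \<otimes>\<^bsub>A\<^esub> y) = f x \<otimes>\<^bsub>B\<^esub> f y"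
    and "f \<one>\<^bsub>A\<^esub> = \<one>\<^bsub>B\<^esub>"
    and "x \<in> carrier A \<Longrightarrow> f (z \<odot>\<^bsub>A\<^esub> x) = z \<odot>\<^bsub>B\<^esub> f x"
    and "x \<in> carrier A \<Longrightarrow> f (star A x) = star B (f x)"
  using assms by (auto simp: star_hom_def ring_hom_def)

lemma spectrumD:
  assumes "p \<in> spectrum A T"
  shows "x \<in> carrier A \<Longrightarrow> y \<in> carrier A \<Longrightarrow> p (x \<oplus>\<^bsub>A\<^esub> y) = p x + p y"
    and "x \<in> carrier A \<Longrightarrow> y \<in> carrier A \<Longrightarrow> p (x \<otimes>\<^bsub>A\<^esub> y) = p x * p y"
    and "p \<one>\<^bsub>A\<^esub> = 1"
    and "x \<in> carrier A \<Longrightarrow> p (z \<odot>\<^bsub>A\<^esub> x) = z * p x"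
    and "x \<in> carrier A \<Longrightarrow> p (star A x) = cnj (p x)"
  using assms star_homD[of p A complex_alg] by (auto simp: spectrum_def complex_alg_def)

context star_algebra
begin

text \<open>The scalars \<^const>\<open>complex_alg\<close> form a second ring in this context, and the short names of ring
  facts can refer to it; the closure laws of the algebra itself are fixed here.\<close>

lemma ring_algebra: "ring A"
  using complex_algebra_axioms by (rule complex_algebra.axioms)

lemmas unit_mem = ring.ring_simprules(6)[OF ring_algebra]
  and add_mem = ring.ring_simprules(1)[OF ring_algebra]
  and mult_mem = ring.ring_simprules(5)[OF ring_algebra]

lemma carrier_nonempty: "carrier A \<noteq> {}"
  using unit_mem by blast

lemma smult_mem: "x \<in> carrier A \<Longrightarrow> z \<odot> x \<in> carrier A"
  using smult_closed[of z x] by (simp add: complex_alg_def)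

lemma star_subalgebra_image:
  assumes B: "star_algebra B" and f: "f \<in> star_hom A B"
  shows "star_subalgebra (f ` carrier A) B"
proof -
  interpret B: star_algebra B by (rule B)
  interpret ring_hom_ring A B f
    using f by (intro ring_hom_ringI2[OF ring_algebra B.ring_algebra]) (simp add: star_hom_def)
  have "z \<odot>\<^bsub>B\<^esub> f x \<in> f ` carrier A" if "x \<in> carrier A" for z x
    using that smult_mem star_homD(5)[OF f, of x z] by (metis imageI)
  moreover have "star B (f x) \<in> f ` carrier A" if "x \<in> carrier A" for x
    using that star_closed star_homD(6)[OF f, of x] by (metis imageI)
  ultimately show ?thesis
    using img_is_subring[OF ring.carrier_is_subring[OF ring_algebra]] by (auto simp: star_subalgebra_def)
qed

lemma gelfand_star_hom: "gelfand A T \<in> star_hom A (cfun_alg (spectrum_topology A T))"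
proof -
  note top = topspace_spectrum_topology[OF carrier_nonempty]
  have "gelfand A T a \<in> carrier (cfun_alg (spectrum_topology A T))" if "a \<in> carrier A" for a
    using continuous_map_evaluation[OF that, of T]
      continuous_map_restrict_topspace[of "spectrum_topology A T" euclidean "\<lambda>p. p a"]
    by (simp add: cfun_alg_def gelfand_def top)
  then show ?thesis
    unfolding star_hom_def ring_hom_def
    by (auto simp: cfun_alg_def gelfand_def top spectrumD fun_eq_iff)
qed

lemma spectrum_eqI:
  assumes "p \<in> spectrum A T" "q \<in> spectrum A T" "\<And>a. a \<in> carrier A \<Longrightarrow> p a = q a"
  shows "p = q"
  using assms by (auto simp: spectrum_def intro: extensionalityI)

lemma gelfand_approximates:
  assumes K: "compactin (spectrum_topology A T) K"
    and g: "continuous_map (spectrum_topology A T) euclidean g" and e: "0 < e"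
  shows "\<exists>a \<in> carrier A. \<forall>p \<in> K. cmod (p a - g p) < e"
proof -
  note ne = carrier_nonempty
  have KS: "K \<subseteq> spectrum A T"
    using compactin_subset_topspace[OF K] by (simp add: topspace_spectrum_topology[OF ne])
  \<comment> \<open>Values are prescribed on the spectrum only: an arbitrary function on the algebra does not
    respect the operations, so evaluations on the whole type are not closed under pointwise sums
    and products.\<close>
  define B where "B = {f. \<exists>a \<in> carrier A. \<forall>p \<in> spectrum A T. f p = p a}"
  have B_I: "f \<in> B" if "a \<in> carrier A" "\<And>p. p \<in> spectrum A T \<Longrightarrow> f p = p a" for f a
    using that by (auto simp: B_def)
  have "\<exists>f \<in> B. \<forall>p \<in> K. cmod (f p - g p) < e"
  proof (rule Stone_Weierstrass_complex)
    show "compact K"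
      using ne K by (rule compact_spectrum)
    show "continuous_on K g"
      using continuous_on_spectrum[OF ne g] KS by (rule continuous_on_subset)
    show "(\<lambda>_. 1) \<in> B"
      by (rule B_I[OF unit_mem]) (simp add: spectrumD)
    show "\<exists>f \<in> B. f p \<noteq> f q" if pq: "p \<in> K" "q \<in> K" "p \<noteq> q" for p q
    proof -
      obtain a where "a \<in> carrier A" "p a \<noteq> q a"
        using spectrum_eqI[of p T q] pq KS by blast
      then show ?thesis
        by (intro bexI[of _ "\<lambda>p. p a"] B_I) auto
    qed
  next
    fix f assume "f \<in> B"
    then obtain a where a: "a \<in> carrier A" "\<And>p. p \<in> spectrum A T \<Longrightarrow> f p = p a"
      by (auto simp: B_def)
    have "continuous_on (spectrum A T) (\<lambda>p. p a)"
      using continuous_on_spectrum[OF ne continuous_map_evaluation[OF a(1)]] .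
    then show "continuous_on K f"
      using KS a(2) by (metis (no_types, lifting) continuous_on_cong continuous_on_subset)
    show "(\<lambda>x. z * f x) \<in> B" for z
      using a by (intro B_I[OF smult_mem[OF a(1), of z]]) (simp add: spectrumD)
    show "(\<lambda>x. cnj (f x)) \<in> B"
      using a by (intro B_I[OF star_closed[OF a(1)]]) (simp add: spectrumD)
    fix h assume "h \<in> B"
    then obtain b where b: "b \<in> carrier A" "\<And>p. p \<in> spectrum A T \<Longrightarrow> h p = p b"
      by (auto simp: B_def)
    show "(\<lambda>x. f x + h x) \<in> B"
      using a b by (intro B_I[OF add_mem[OF a(1) b(1)]]) (simp add: spectrumD)
    show "(\<lambda>x. f x * h x) \<in> B"
      using a b by (intro B_I[OF mult_mem[OF a(1) b(1)]]) (simp add: spectrumD)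
  qed (rule e)
  then obtain f where f: "f \<in> B" "\<And>p. p \<in> K \<Longrightarrow> cmod (f p - g p) < e"
    by blast
  then obtain a where "a \<in> carrier A" "\<And>p. p \<in> spectrum A T \<Longrightarrow> f p = p a"
    by (auto simp: B_def)
  with f(2) KS show ?thesis
    by (metis subsetD)
qed

lemma gelfand_dense:
  "compact_open (spectrum_topology A T) closure_of (gelfand A T ` carrier A)
    = carrier (cfun_alg (spectrum_topology A T))"
proof (rule antisym)
  let ?X = "spectrum_topology A T"
  show "compact_open ?X closure_of (gelfand A T ` carrier A) \<subseteq> carrier (cfun_alg ?X)"
    using closure_of_subset_topspace by (simp add: topspace_compact_open[symmetric])
  show "carrier (cfun_alg ?X) \<subseteq> compact_open ?X closure_of (gelfand A T ` carrier A)"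
  proof
    fix g assume g: "g \<in> carrier (cfun_alg ?X)"
    have "\<exists>h \<in> gelfand A T ` carrier A. h \<in> U" if "openin (compact_open ?X) U" "g \<in> U" for U
    proof -
      obtain K r where K: "compactin ?X K" and r: "0 < r"
        and nhd: "\<And>h. h \<in> carrier (cfun_alg ?X) \<Longrightarrow>
          (\<And>p. p \<in> K \<Longrightarrow> cmod (h p - g p) < r) \<Longrightarrow> h \<in> U"
        using \<open>openin (compact_open ?X) U\<close> \<open>g \<in> U\<close> by (rule compact_open_nhd) blast
      have "continuous_map ?X euclidean g"
        using g by (simp add: cfun_alg_def)
      then obtain a where a: "a \<in> carrier A" "\<And>p. p \<in> K \<Longrightarrow> cmod (p a - g p) < r"
        using gelfand_approximates[OF K _ r] by blast
      have "K \<subseteq> spectrum A T"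
        using compactin_subset_topspace[OF K]
        by (simp add: topspace_spectrum_topology[OF carrier_nonempty])
      then have "gelfand A T a \<in> U"
        using a by (intro nhd star_homD(1)[OF gelfand_star_hom]) (auto simp: gelfand_def)
      with a(1) show ?thesis by blast
    qed
    then show "g \<in> compact_open ?X closure_of (gelfand A T ` carrier A)"
      using g by (simp add: in_closure_of topspace_compact_open)
  qed
qed

end

theorem theorem8:
  fixes A :: "(complex, 'a, 'm) star_alg_scheme" and T :: "'a topology"
  assumes "locally_convex_star_algebra A T"
    and "\<forall>x \<in> carrier A. \<forall>y \<in> carrier A. x \<otimes>\<^bsub>A\<^esub> y = y \<otimes>\<^bsub>A\<^esub> x"
    and "semisimple A T"
  shows "gelfand A T \<in> star_hom A (cfun_alg (spectrum_topology A T)) \<and>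
    star_subalgebra (gelfand A T ` carrier A) (cfun_alg (spectrum_topology A T)) \<and>
    compact_open (spectrum_topology A T) closure_of (gelfand A T ` carrier A)
      = carrier (cfun_alg (spectrum_topology A T))"
proof -
  interpret locally_convex_star_algebra A T by (rule assms(1))
  show ?thesis
    using gelfand_star_hom star_subalgebra_image[OF star_algebra_cfun_alg gelfand_star_hom]
      gelfand_dense by blast
qed

end
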